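(* Let $n\ge 1$, let $U\subset\mathrm{Sym}(n)$ be an open subset, and let $F:U\to\mathbb{R}$ be a $C^1$ function satisfying the following conditions: (i) (Ellipticity) $DF(B)$ is positive definite for every $B\in U$; (ii) (Upper boundedness) there exists a constant $c\in\mathbb{R}$ such that $F(B)\le c$ for every $B\in U$; (iii) (Coefficient control) there exists a continuous nonnegative function $G$ on $(-\infty,c]$, with $c$ the constant in (ii), such that $\operatorname{tr}(DF(B))\le G(F(B))$ for every $B\in U$. Let $u:\mathbb{R}^n\to\mathbb{R}$ be a $C^3$ function satisfying (with $D^2u(x)\in U$ for every $x\in\mathbb{R}^n$) $$F(D^2u)=\frac{1}{2}\,x\cdot Du-u\qquad\text{on }\mathbb{R}^n.$$ Then $u$ is a quadratic polynomial.
   Context: $\mathrm{Sym}(n)$ denotes the space of real symmetric $n\times n$ matrices. For $B\in U$, $DF(B)\in\mathrm{Sym}(n)$ denotes the linearized coefficient matrix of $F$ at $B$, defined by $\frac{d}{dt}\big|_{t=0}F(B+tK)=\operatorname{tr}(DF(B)K)$ for every $K\in\mathrm{Sym}(n)$. $Du$ and $D^2u$ are the gradient and Hessian of $u$, and "$\cdot$" is the Euclidean inner product. "Quadratic polynomial" means a real polynomial of degree at most $2$ (equivalently, $D^2u$ is constant). *)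

theory Defs
  imports "HOL-Analysis.Analysis"
begin

definition Sym :: "(real^'n^'n) set" where
  "Sym = {A. transpose A = A}"

definition positive_definite :: "real^'n^'n \<Rightarrow> bool" where
  "positive_definite A \<longleftrightarrow> A \<in> Sym \<and> (\<forall>x. x \<noteq> 0 \<longrightarrow> 0 < x \<bullet> (A *v x))"

text \<open>
  \<open>C1_on U F\<close> is used for \<open>U\<close> relatively open in the subspace \<open>Sym\<close>. Only the restriction of
  \<open>F' B\<close> to \<open>Sym\<close> is then determined by \<open>F\<close>. Asking for some continuous choice of \<open>F'\<close> is
  the usual notion of being continuously differentiable on an open subset of \<open>Sym\<close>, because the
  derivative on \<open>Sym\<close> extends to all matrices by precomposition with a linear projection.
\<close>

definition C1_on ::
  "'a::real_normed_vector set \<Rightarrow> ('a \<Rightarrow> real) \<Rightarrow> bool" where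
  "C1_on U F \<longleftrightarrow>
     (\<exists>F' :: 'a \<Rightarrow> 'a \<Rightarrow>\<^sub>L real.
        (\<forall>B\<in>U. (F has_derivative blinfun_apply (F' B)) (at B within U)) \<and> continuous_on U F')"

text \<open>
  The matrix is required to lie in \<open>Sym\<close> and is thereby unique, since \<open>(A, K) \<mapsto> trace (A ** K)\<close>
  is an inner product on \<open>Sym\<close>. When \<open>U\<close> is relatively open in \<open>Sym\<close> and \<open>B \<in> U\<close>, values
  of \<open>F\<close> outside \<open>U\<close> do not matter.
\<close>

definition linearized_coeff :: "(real^'n^'n \<Rightarrow> real) \<Rightarrow> real^'n^'n \<Rightarrow> real^'n^'n" where
  "linearized_coeff F B =
     (THE A. A \<in> Sym \<and>
        (\<forall>K\<in>Sym. ((\<lambda>t. F (B + t *\<^sub>R K)) has_real_derivative trace (A ** K)) (at 0)))"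

primrec Ck :: "nat \<Rightarrow> ('a::real_normed_vector \<Rightarrow> real) \<Rightarrow> bool" where
  "Ck 0 f \<longleftrightarrow> continuous_on UNIV f"
| "Ck (Suc k) f \<longleftrightarrow>
     (\<forall>x. f differentiable (at x)) \<and> (\<forall>v. Ck k (\<lambda>x. frechet_derivative f (at x) v))"

definition gradient :: "(real^'n \<Rightarrow> real) \<Rightarrow> real^'n \<Rightarrow> real^'n" where
  "gradient u x = (\<chi> i. frechet_derivative u (at x) (axis i 1))"

definition hessian :: "(real^'n \<Rightarrow> real) \<Rightarrow> real^'n \<Rightarrow> real^'n^'n" where
  "hessian u x = jacobian (gradient u) (at x)"

definition quadratic_polynomial :: "(real^'n \<Rightarrow> real) \<Rightarrow> bool" where
  "quadratic_polynomial u \<longleftrightarrow>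
     (\<exists>a b c. \<forall>x. u x = (\<Sum>i\<in>UNIV. \<Sum>j\<in>UNIV. a i j * x $ i * x $ j) + (\<Sum>i\<in>UNIV. b i * x $ i) + c)"

end

theory Submission
  imports Defs
begin

text \<open>
  Put \<open>f = F(D\<^sup>2u) = x \<bullet> Du / 2 - u\<close> and \<open>a(x) = DF(D\<^sup>2u(x))\<close>. Differentiating the two expressions
  for \<open>f\<close> gives \<open>tr (a D\<^sup>2f) = x \<bullet> Df / 2\<close>. Since \<open>tr a \<le> G(f)\<close> is bounded on \<open>{f \<ge> f 0}\<close>, the
  function \<open>|x|\<^sup>2\<close> is a supersolution on that set far from the origin, and comparison with
  \<open>\<epsilon>|x|\<^sup>2\<close> shows that \<open>f\<close> attains its supremum. By the strong maximum principle \<open>f\<close> is constant.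
  Then \<open>0 = 2 Df = D\<^sup>2u x - Du\<close>, so \<open>Du\<close> is homogeneous of degree one and differentiable at the
  origin, hence linear.
\<close>

section \<open>Traces of products with positive semidefinite matrices\<close>

lemma trace_mult: "trace (A ** B) = (\<Sum>i\<in>UNIV. \<Sum>j\<in>UNIV. A $ i $ j * B $ j $ i)"
  for A B :: "real^'n^'n"
  by (simp add: trace_def matrix_matrix_mult_def)

lemma trace_mult_scaleR_right: "trace (A ** (c *\<^sub>R B)) = c * trace (A ** B)"
  for A B :: "real^'n^'n"
  by (simp add: trace_mult sum_distrib_left mult_ac)

lemma trace_mult_diff_right: "trace (A ** (B - C)) = trace (A ** B) - trace (A ** C)"
  for A B C :: "real^'n^'n"
  by (simp add: trace_mult right_diff_distrib sum_subtractf)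

lemma trace_mult_outer: "trace (A ** (\<chi> i j. v $ i * v $ j)) = v \<bullet> (A *v v)"
  for A :: "real^'n^'n"
  by (simp add: trace_mult inner_vec_def matrix_vector_mult_def sum_distrib_left mult_ac)

lemma outer_mult_vec: "(\<chi> i j. x $ i * x $ j) *v v = (x \<bullet> v) *\<^sub>R x"
  for x v :: "real^'n"
  by (simp add: vec_eq_iff matrix_vector_mult_def inner_vec_def sum_distrib_left
      sum_distrib_right mult_ac)

lemma symmetric_inner_commute:
  fixes A :: "real^'n^'n"
  assumes "transpose A = A"
  shows "x \<bullet> (A *v y) = y \<bullet> (A *v x)"
  by (metis assms dot_lmul_matrix inner_commute transpose_matrix_vector)

text \<open>On the span of \<open>axis k 1\<close> and \<open>axis j 1\<close>, a vanishing
  \<open>A $ k $ k\<close> makes the form affine in the coefficient of \<open>axis k 1\<close>, and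
  a nonzero slope would drive it below zero. This disposes of zero pivots in the elimination
  below.\<close>

lemma semidefinite_zero_diagonal:
  fixes A :: "real^'n^'n"
  assumes sym: "transpose A = A" and psd: "\<And>x. 0 \<le> x \<bullet> (A *v x)" and z: "A $ k $ k = 0"
  shows "A $ k $ j = 0"
proof (rule ccontr)
  assume nz: "A $ k $ j \<noteq> 0"
  have ent: "axis i 1 \<bullet> (A *v axis l 1) = A $ i $ l" for i l
    by (simp add: inner_axis' matrix_vector_mul_component inner_axis)
  \<comment> \<open>Solves \<open>2 * t * A $ k $ j + A $ j $ j = -1\<close>.\<close>
  define t where "t = - (A $ j $ j + 1) / (2 * A $ k $ j)"
  have "0 \<le> (t *\<^sub>R axis k 1 + axis j 1) \<bullet> (A *v (t *\<^sub>R axis k 1 + axis j 1))"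
    by (rule psd)
  also have "\<dots> = t * t * A $ k $ k + t * A $ k $ j + t * A $ j $ k + A $ j $ j"
    by (simp add: matrix_vector_right_distrib inner_add_left inner_add_right ent
        matrix_vector_mult_scaleR algebra_simps)
  also have "A $ j $ k = A $ k $ j"
    using symmetric_inner_commute[OF sym, of "axis j 1" "axis k 1"] by (simp only: ent)
  also have "t * t * A $ k $ k + t * A $ k $ j + t * A $ k $ j + A $ j $ j = -1"
    using nz z by (simp add: t_def field_simps)
  finally show False by simp
qed

text \<open>Symmetric Gaussian elimination writes \<open>A\<close> as a sum of rank-one matrices \<open>v v\<^sup>T\<close>, and
  the trace of \<open>v v\<^sup>T Q\<close> is \<open>v \<bullet> Q v\<close>; no symmetry of \<open>Q\<close> is involved.\<close>

lemma trace_mult_nonpos: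
  fixes A Q :: "real^'n^'n"
  assumes sym: "transpose A = A" and psd: "\<And>x. 0 \<le> x \<bullet> (A *v x)"
    and nsd: "\<And>v. v \<bullet> (Q *v v) \<le> 0"
  shows "trace (A ** Q) \<le> 0"
proof -
  have "trace (A ** Q) \<le> 0"
    if "finite S" "transpose A = A" "\<And>x. 0 \<le> x \<bullet> (A *v x)" "\<And>i j. i \<notin> S \<Longrightarrow> A $ i $ j = 0"
    for S :: "'n set" and A :: "real^'n^'n"
    using that
  proof (induction S arbitrary: A rule: finite_induct)
    case empty
    then show ?case by (simp add: trace_mult)
  next
    case (insert k S)
    note sym = insert.prems(1) and psd = insert.prems(2) and supp = insert.prems(3)
    show ?case
    proof (cases "A $ k $ k = 0")
      case True
      have "A $ i $ j = 0" if "i \<notin> S" for i j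
        using semidefinite_zero_diagonal[OF sym psd True] supp that by (metis insertE)
      then show ?thesis
        using insert.IH sym psd by blast
    next
      case False
      define d where "d = A $ k $ k"
      have d_eq: "d = axis k 1 \<bullet> (A *v axis k 1)"
        by (simp add: d_def inner_axis' matrix_vector_mul_component inner_axis)
      then have d: "d > 0"
        using psd[of "axis k 1"] False by (simp add: d_def)
      define v where "v = A *v axis k 1"
      \<comment> \<open>Schur complement of the pivot \<open>d\<close>: row and column
        \<open>k\<close> are cleared, so the support shrinks from \<open>insert k S\<close> to
        \<open>S\<close>.\<close>
      define B where "B = A - (1 / d) *\<^sub>R (\<chi> i j. v $ i * v $ j)"
      have v_nth: "v $ i = A $ i $ k" for i
        by (simp add: v_def matrix_vector_mul_component inner_axis)
      have A_sym: "A $ i $ j = A $ j $ i" for i j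
        using sym by (metis transpose_def vec_lambda_beta)
      have B_vec: "B *v x = A *v x - ((v \<bullet> x) / d) *\<^sub>R v" for x
        by (simp add: B_def matrix_vector_mult_diff_rdistrib outer_mult_vec
            flip: scaleR_matrix_vector_assoc)
      have 1: "transpose B = B"
        using A_sym by (simp add: B_def transpose_def vec_eq_iff mult_ac)
      have 2: "0 \<le> x \<bullet> (B *v x)" for x
      proof -
        define p where "p = v \<bullet> x"
        have p: "axis k 1 \<bullet> (A *v x) = p" "x \<bullet> v = p"
          using symmetric_inner_commute[OF sym, of "axis k 1" x]
          by (simp_all add: p_def v_def inner_commute)
        \<comment> \<open>Completing the square: this shift along \<open>axis k 1\<close> minimises
          the form of \<open>A\<close>, and the minimum is the form of \<open>B\<close> at
          \<open>x\<close>.\<close>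
        have "0 \<le> (x - (p / d) *\<^sub>R axis k 1) \<bullet> (A *v (x - (p / d) *\<^sub>R axis k 1))"
          by (rule psd)
        also have "\<dots> = x \<bullet> (A *v x) - p / d * p - p / d * p + (p / d) * (p / d) * d"
          using p d_eq
          by (simp add: matrix_vector_mult_diff_distrib inner_diff_left inner_diff_right
              matrix_vector_mult_scaleR flip: v_def)
        also have "\<dots> = x \<bullet> (A *v x) - p / d * p"
          using d by simp
        also have "\<dots> = x \<bullet> (B *v x)"
          by (simp add: B_vec inner_diff_right p flip: p_def)
        finally show ?thesis .
      qed
      have 3: "B $ i $ j = 0" if "i \<notin> S" for i j
        using supp[of i j] supp[of i k] that d A_sym[of k j] unfolding B_def
        by (cases "i = k") (auto simp: v_nth d_def)
      have "trace (A ** Q) = trace (B ** Q) + (1 / d) * (v \<bullet> (Q *v v))"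
        unfolding trace_mul_sym[of _ Q] B_def
        by (simp add: trace_mult_diff_right trace_mult_scaleR_right trace_mult_outer)
      moreover have "trace (B ** Q) \<le> 0"
        using insert.IH[OF 1 2 3] .
      moreover have "(1 / d) * (v \<bullet> (Q *v v)) \<le> 0"
        using d nsd[of v] by (simp add: mult_nonneg_nonpos divide_nonpos_pos)
      ultimately show ?thesis by linarith
    qed
  qed
  from this[of UNIV A] sym psd show ?thesis by simp
qed

section \<open>Second-order conditions at a local maximum\<close>

text \<open>If \<open>v \<bullet> (Q *v v)\<close> were positive, the slope \<open>h\<close> of
  \<open>f\<close> along the ray from \<open>x\<close> in direction \<open>v\<close> would start at
  0 and be positive just after, so by the mean value theorem \<open>f\<close> would exceed its
  maximum.\<close>

lemma second_derivative_test:
  fixes f :: "real^'n \<Rightarrow> real"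
  assumes S: "open S" "x \<in> S"
    and P: "\<And>y. y \<in> S \<Longrightarrow> (f has_derivative (\<lambda>v. P y \<bullet> v)) (at y)"
    and Q: "(P has_derivative (\<lambda>v. Q *v v)) (at x)"
    and max: "\<And>y. y \<in> S \<Longrightarrow> f y \<le> f x"
  shows "P x = 0" and "v \<bullet> (Q *v v) \<le> 0"
proof -
  show P0: "P x = 0"
    using differential_zero_maxmin[OF S(2,1) P[OF S(2)]] max
    by (metis inner_eq_zero_iff)
  show "v \<bullet> (Q *v v) \<le> 0"
  proof (rule ccontr)
    assume "\<not> v \<bullet> (Q *v v) \<le> 0"
    then have pos: "v \<bullet> (Q *v v) > 0" by simp
    define h where "h t = P (x + t *\<^sub>R v) \<bullet> v" for t
    have "((\<lambda>t. P (x + t *\<^sub>R v)) has_derivative (\<lambda>t. Q *v (t *\<^sub>R v))) (at 0)"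
      by (rule has_derivative_compose[of "\<lambda>t. x + t *\<^sub>R v" "\<lambda>t. t *\<^sub>R v" 0 UNIV P])
        (auto intro!: derivative_eq_intros simp: Q)
    then have "(h has_derivative (\<lambda>t. (Q *v (t *\<^sub>R v)) \<bullet> v)) (at 0)"
      unfolding h_def by (intro has_derivative_inner_left)
    then have h': "(h has_real_derivative (v \<bullet> (Q *v v))) (at 0)"
      by (simp add: has_field_derivative_def matrix_vector_mult_scaleR inner_commute mult_commute_abs)
    have h0: "h 0 = 0" by (simp add: h_def P0)
    obtain d where d: "d > 0" "\<And>t. 0 < t \<Longrightarrow> t < d \<Longrightarrow> h t > 0"
      using DERIV_pos_inc_right[OF h' pos] h0 by auto
    have "open ((\<lambda>t::real. x + t *\<^sub>R v) -` S)"
      by (intro open_vimage S continuous_intros)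
    moreover have "0 \<in> (\<lambda>t::real. x + t *\<^sub>R v) -` S" using S by simp
    ultimately obtain e where e: "e > 0" "ball 0 e \<subseteq> (\<lambda>t::real. x + t *\<^sub>R v) -` S"
      by (meson openE)
    have inS: "x + t *\<^sub>R v \<in> S" if "0 \<le> t" "t < e" for t
      using e(2) that by (auto simp: subset_iff dist_norm)
    define s where "s = min d e / 2"
    have s: "0 < s" "s < d" "s < e" using d(1) e(1) by (auto simp: s_def)
    have f': "((\<lambda>t. f (x + t *\<^sub>R v)) has_real_derivative h t) (at t)"
      if "0 \<le> t" "t \<le> s" for t
    proof -
      have "((\<lambda>t. f (x + t *\<^sub>R v)) has_derivative (\<lambda>r. P (x + t *\<^sub>R v) \<bullet> (r *\<^sub>R v))) (at t)"
        by (rule has_derivative_compose[of "\<lambda>t. x + t *\<^sub>R v" "\<lambda>t. t *\<^sub>R v" t UNIV f])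
          (use that s in \<open>auto intro!: derivative_eq_intros P inS\<close>)
      then show ?thesis
        by (simp add: has_field_derivative_def h_def mult_commute_abs)
    qed
    obtain t where "0 < t" "t < s" "f (x + s *\<^sub>R v) - f (x + 0 *\<^sub>R v) = (s - 0) * h t"
      using MVT2[OF s(1), of "\<lambda>t. f (x + t *\<^sub>R v)" h] f' by auto
    moreover from this have "(s - 0) * h t > 0" using d(2)[of t] s by simp
    ultimately show False using max[OF inS[of s]] s by simp
  qed
qed

section \<open>Symmetry of second derivatives\<close>

text \<open>The mean value theorem is applied twice: along \<open>v\<close> to the increment of
  \<open>f\<close> over \<open>s *\<^sub>R w\<close>, then along \<open>w\<close> to the derivative
  of \<open>f\<close> in direction \<open>v\<close>.\<close>

lemma second_difference_MVT:
  fixes f :: "real^'n \<Rightarrow> real"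
  assumes f: "\<And>x. f differentiable (at x)"
    and fv: "\<And>x. (\<lambda>y. frechet_derivative f (at y) v) differentiable (at x)"
    and s: "0 < s"
  obtains p q where "0 < p" "p < s" "0 < q" "q < s"
    "f (x + s *\<^sub>R v + s *\<^sub>R w) - f (x + s *\<^sub>R v) - f (x + s *\<^sub>R w) + f x
      = s * s * frechet_derivative (\<lambda>y. frechet_derivative f (at y) v)
          (at (x + p *\<^sub>R v + q *\<^sub>R w)) w"
proof -
  have line: "((\<lambda>t. g (z + t *\<^sub>R v)) has_real_derivative
      frechet_derivative g (at (z + t *\<^sub>R v)) v) (at t)"
    if "\<And>x. g differentiable (at x)" for g :: "real^'n \<Rightarrow> real" and z v t
  proof -
    have *: "(g has_derivative frechet_derivative g (at y)) (at y)" for y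
      using that frechet_derivative_works by blast
    have "((\<lambda>t. g (z + t *\<^sub>R v)) has_derivative
        (\<lambda>r. frechet_derivative g (at (z + t *\<^sub>R v)) (r *\<^sub>R v))) (at t)"
      by (rule has_derivative_compose[of "\<lambda>t. z + t *\<^sub>R v" "\<lambda>t. t *\<^sub>R v" t UNIV g])
        (auto intro!: derivative_eq_intros *)
    then show ?thesis
      using linear_scale[OF has_derivative_linear[OF *]]
      by (simp add: has_field_derivative_def mult_commute_abs)
  qed
  define fv where "fv y = frechet_derivative f (at y) v" for y
  have *: "((\<lambda>t. f ((x + s *\<^sub>R w) + t *\<^sub>R v) - f (x + t *\<^sub>R v)) has_real_derivative
      fv ((x + s *\<^sub>R w) + t *\<^sub>R v) - fv (x + t *\<^sub>R v)) (at t)" for t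
    unfolding fv_def by (intro DERIV_diff line f)
  obtain p where p: "0 < p" "p < s"
    "(f ((x + s *\<^sub>R w) + s *\<^sub>R v) - f (x + s *\<^sub>R v)) - (f ((x + s *\<^sub>R w) + 0 *\<^sub>R v) - f (x + 0 *\<^sub>R v))
      = (s - 0) * (fv ((x + s *\<^sub>R w) + p *\<^sub>R v) - fv (x + p *\<^sub>R v))"
    using MVT2[OF s *] by blast
  have "((\<lambda>t. fv ((x + p *\<^sub>R v) + t *\<^sub>R w)) has_real_derivative
      frechet_derivative fv (at ((x + p *\<^sub>R v) + t *\<^sub>R w)) w) (at t)" for t
    by (rule line) (use assms(2) in \<open>simp add: fv_def[abs_def]\<close>)
  from MVT2[OF s this] obtain q where q: "0 < q" "q < s"
    "fv ((x + p *\<^sub>R v) + s *\<^sub>R w) - fv ((x + p *\<^sub>R v) + 0 *\<^sub>R w)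
      = (s - 0) * frechet_derivative fv (at ((x + p *\<^sub>R v) + q *\<^sub>R w)) w"
    by blast
  show thesis
  proof (rule that[OF p(1,2) q(1,2)])
    have "f (x + s *\<^sub>R v + s *\<^sub>R w) - f (x + s *\<^sub>R v) - f (x + s *\<^sub>R w) + f x
      = s * (fv ((x + p *\<^sub>R v) + s *\<^sub>R w) - fv (x + p *\<^sub>R v))"
      using p(3) by (simp add: add_ac algebra_simps)
    also have "\<dots> = s * (s * frechet_derivative fv (at ((x + p *\<^sub>R v) + q *\<^sub>R w)) w)"
      using q(3) by simp
    finally show "f (x + s *\<^sub>R v + s *\<^sub>R w) - f (x + s *\<^sub>R v) - f (x + s *\<^sub>R w) + f x
      = s * s * frechet_derivative (\<lambda>y. frechet_derivative f (at y) v)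
          (at (x + p *\<^sub>R v + q *\<^sub>R w)) w"
      by (simp add: fv_def[abs_def])
  qed
qed

text \<open>Schwarz's theorem. The second difference is unchanged when \<open>v\<close> and
  \<open>w\<close> are exchanged, so the two mixed derivatives agree when taken at two suitable
  points near \<open>x\<close>; continuity moves both points to \<open>x\<close>.\<close>

lemma frechet_derivative_swap:
  fixes f :: "real^'n \<Rightarrow> real"
  assumes f: "\<And>x. f differentiable (at x)"
    and f': "\<And>v x. (\<lambda>y. frechet_derivative f (at y) v) differentiable (at x)"
    and cont: "\<And>v w. continuous_on UNIV
        (\<lambda>x. frechet_derivative (\<lambda>y. frechet_derivative f (at y) v) (at x) w)"
  shows "frechet_derivative (\<lambda>y. frechet_derivative f (at y) v) (at x) w
    = frechet_derivative (\<lambda>y. frechet_derivative f (at y) w) (at x) v"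
proof -
  define D where "D v w x = frechet_derivative (\<lambda>y. frechet_derivative f (at y) v) (at x) w"
    for v w x
  have small: "\<exists>d>0. \<forall>s p q. 0 < s \<longrightarrow> s < d \<longrightarrow> 0 < p \<longrightarrow> p < s \<longrightarrow> 0 < q \<longrightarrow> q < s \<longrightarrow>
      dist (D v w (x + p *\<^sub>R v + q *\<^sub>R w)) (D v w x) < e" if e: "e > 0" for v w and e :: real
  proof -
    obtain r where r: "r > 0" "\<And>y. dist y x < r \<Longrightarrow> dist (D v w y) (D v w x) < e"
      using cont[of v w] e unfolding continuous_on_iff D_def by (metis UNIV_I)
    \<comment> \<open>Keeps \<open>x + p *\<^sub>R v + q *\<^sub>R w\<close> within \<open>r\<close>
      of \<open>x\<close> for \<open>p, q < s < d\<close>. The summand 1 keeps the denominator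
      positive when \<open>v\<close> and \<open>w\<close> vanish.\<close>
    define d where "d = r / (norm v + norm w + 1)"
    have N: "norm v + norm w + 1 > 0"
      by (simp add: add_nonneg_pos)
    have "dist (x + p *\<^sub>R v + q *\<^sub>R w) x < r"
      if "s < d" "0 < p" "p < s" "0 < q" "q < s" for s p q
    proof -
      have "dist (x + p *\<^sub>R v + q *\<^sub>R w) x \<le> norm (p *\<^sub>R v) + norm (q *\<^sub>R w)"
        by (simp add: dist_norm add.assoc norm_triangle_ineq del: norm_scaleR)
      also have "\<dots> \<le> s * norm v + s * norm w"
        using that by (intro add_mono) (auto intro: mult_right_mono)
      also have "\<dots> < s * (norm v + norm w + 1)"
        using that by (simp add: algebra_simps)
      also have "\<dots> < d * (norm v + norm w + 1)"
        using that N by (intro mult_strict_right_mono) auto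
      also have "\<dots> = r" using N by (simp add: d_def)
      finally show ?thesis .
    qed
    moreover have "d > 0" using r(1) N by (simp add: d_def)
    ultimately show ?thesis using r(2) by blast
  qed
  have "dist (D v w x) (D w v x) \<le> e" if e: "e > 0" for e
  proof -
    obtain d1 where d1: "d1 > 0" "\<And>s p q. 0 < s \<Longrightarrow> s < d1 \<Longrightarrow> 0 < p \<Longrightarrow> p < s \<Longrightarrow> 0 < q \<Longrightarrow> q < s \<Longrightarrow>
      dist (D v w (x + p *\<^sub>R v + q *\<^sub>R w)) (D v w x) < e / 2"
      using small[OF half_gt_zero[OF e], of v w] by blast
    obtain d2 where d2: "d2 > 0" "\<And>s p q. 0 < s \<Longrightarrow> s < d2 \<Longrightarrow> 0 < p \<Longrightarrow> p < s \<Longrightarrow> 0 < q \<Longrightarrow> q < s \<Longrightarrow>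
      dist (D w v (x + p *\<^sub>R w + q *\<^sub>R v)) (D w v x) < e / 2"
      using small[OF half_gt_zero[OF e], of w v] by blast
    define s where "s = min d1 d2 / 2"
    have s: "0 < s" "s < d1" "s < d2" using d1(1) d2(1) by (auto simp: s_def)
    obtain p q where pq: "0 < p" "p < s" "0 < q" "q < s"
      "f (x + s *\<^sub>R v + s *\<^sub>R w) - f (x + s *\<^sub>R v) - f (x + s *\<^sub>R w) + f x
        = s * s * D v w (x + p *\<^sub>R v + q *\<^sub>R w)"
      unfolding D_def using second_difference_MVT[of f v s x w, OF f f' s(1)] by blast
    obtain p' q' where pq': "0 < p'" "p' < s" "0 < q'" "q' < s"
      "f (x + s *\<^sub>R w + s *\<^sub>R v) - f (x + s *\<^sub>R w) - f (x + s *\<^sub>R v) + f x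
        = s * s * D w v (x + p' *\<^sub>R w + q' *\<^sub>R v)"
      unfolding D_def using second_difference_MVT[of f w s x v, OF f f' s(1)] by blast
    have "f (x + s *\<^sub>R w + s *\<^sub>R v) = f (x + s *\<^sub>R v + s *\<^sub>R w)"
      by (simp add: add_ac)
    then have "s * s * D v w (x + p *\<^sub>R v + q *\<^sub>R w) = s * s * D w v (x + p' *\<^sub>R w + q' *\<^sub>R v)"
      using pq(5) pq'(5) by linarith
    then have "D v w (x + p *\<^sub>R v + q *\<^sub>R w) = D w v (x + p' *\<^sub>R w + q' *\<^sub>R v)"
      using s(1) by simp
    then show ?thesis
      using d1(2)[OF s(1,2) pq(1-4)] d2(2)[OF s(1,3) pq'(1-4)]
        dist_triangle3[of "D v w x" "D w v x" "D v w (x + p *\<^sub>R v + q *\<^sub>R w)"]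
      by simp
  qed
  then have "dist (D v w x) (D w v x) \<le> 0" by (rule field_le_epsilon) simp
  then show ?thesis by (simp add: D_def)
qed

text \<open>The form in which both comparison arguments below use an interior maximum: the
  first-order term is known and the elliptic second-order term has a sign.\<close>

lemma trace_hessian_nonpos_at_max:
  fixes f :: "real^'n \<Rightarrow> real"
  assumes S: "open S" "x \<in> S"
    and P: "\<And>y. y \<in> S \<Longrightarrow> (f has_derivative (\<lambda>v. P y \<bullet> v)) (at y)"
    and Q: "(P has_derivative (\<lambda>v. Q *v v)) (at x)"
    and max: "\<And>y. y \<in> S \<Longrightarrow> f y \<le> f x"
    and A: "positive_definite A"
  shows "P x = 0" and "trace (A ** Q) \<le> 0"
proof -
  show "P x = 0" by (rule second_derivative_test(1)[OF S P Q max])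
  have "v \<bullet> (Q *v v) \<le> 0" for v by (rule second_derivative_test(2)[OF S P Q max])
  moreover have "0 \<le> v \<bullet> (A *v v)" for v
    using A by (cases "v = 0") (auto simp: positive_definite_def less_imp_le)
  ultimately show "trace (A ** Q) \<le> 0"
    using A by (intro trace_mult_nonpos) (auto simp: positive_definite_def Sym_def)
qed

lemma mat_1_scaleR_vec: "(c *\<^sub>R mat 1) *v v = c *\<^sub>R v"
  for v :: "real^'n"
  by (simp flip: scaleR_matrix_vector_assoc)

section \<open>Attainment of the supremum\<close>

text \<open>The candidate \<open>z\<close> maximises \<open>f\<close> over a ball of radius
  \<open>R\<close>. Comparison gives \<open>f x \<le> f z + e * (x \<bullet> x)\<close> everywhere
  for each \<open>e > 0\<close>, and \<open>e\<close> then tends to 0.\<close>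

lemma bounded_above_solution_attains_max:
  fixes f :: "real^'n \<Rightarrow> real" and a Q :: "real^'n \<Rightarrow> real^'n^'n"
  assumes P: "\<And>x. (f has_derivative (\<lambda>v. P x \<bullet> v)) (at x)"
    and Q: "\<And>x. (P has_derivative (\<lambda>v. Q x *v v)) (at x)"
    and a: "\<And>x. positive_definite (a x)"
    and eq: "\<And>x. trace (a x ** Q x) = 1/2 * (x \<bullet> P x)"
    and upper: "\<And>x. f x \<le> c"
    and G: "continuous_on {..c} G"
    and tr: "\<And>x. trace (a x) \<le> G (f x)"
  shows "\<exists>z. \<forall>x. f x \<le> f z"
proof -
  \<comment> \<open>Only points with \<open>f p > f z \<ge> f 0\<close> are tested below, so a bound
    for \<open>G\<close> on this compact interval suffices.\<close>
  have "continuous_on {f 0..c} G" by (rule continuous_on_subset[OF G]) auto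
  then obtain s0 where s0: "\<And>s. s \<in> {f 0..c} \<Longrightarrow> G s \<le> G s0"
    using continuous_attains_sup[of "{f 0..c}" G] upper[of 0] by (metis atLeastatMost_empty_iff2 compact_Icc not_less)
  have fcont: "continuous_on A f" for A
    by (intro continuous_at_imp_continuous_on ballI has_derivative_continuous[OF P])
  \<comment> \<open>Large enough that \<open>2 * G s0 < R * R\<close>; \<open>R \<ge> 1\<close> also
    yields \<open>norm p \<le> p \<bullet> p\<close> for points outside the ball.\<close>
  define R where "R = 2 * \<bar>G s0\<bar> + 1"
  have R: "R \<ge> 1" "2 * G s0 < R * R"
  proof -
    show *: "R \<ge> 1" by (simp add: R_def)
    have "2 * G s0 < R" by (simp add: R_def)
    also have "R \<le> R * R" using * by simp
    finally show "2 * G s0 < R * R" .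
  qed
  obtain z where z: "\<And>x. x \<in> cball 0 R \<Longrightarrow> f x \<le> f z"
    using continuous_attains_sup[OF compact_cball _ fcont, of 0 R] R(1)
    by (metis cball_eq_empty not_less not_one_less_zero order.strict_trans1)
  have f0z: "f 0 \<le> f z" using z[of 0] R by simp
  have barrier: "f x \<le> f z + e * (x \<bullet> x)" if e: "e > 0" for e x
  proof (rule ccontr)
    define w where "w y = f y - e * (y \<bullet> y)" for y
    assume "\<not> f x \<le> f z + e * (x \<bullet> x)"
    then have x: "w x > f z" by (simp add: w_def)
    \<comment> \<open>The ball contains \<open>x\<close>, and a maximum point \<open>p\<close> of
      \<open>w\<close> with \<open>w p > f z\<close> must be interior: \<open>f \<le> c\<close>
      forces \<open>p \<bullet> p < (c - f z) / e\<close>, while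
      \<open>norm p \<le> p \<bullet> p\<close>.\<close>
    define L where "L = max (norm x) (((c - f z) / e) + 1)"
    have "continuous_on (cball 0 L) w"
      unfolding w_def by (intro continuous_intros fcont)
    moreover have "x \<in> cball 0 L" by (simp add: L_def)
    ultimately obtain p where p: "p \<in> cball 0 L" "\<And>y. y \<in> cball 0 L \<Longrightarrow> w y \<le> w p"
      using continuous_attains_sup[of "cball 0 L" w] by (metis compact_cball empty_iff)
    have wp: "w p > f z" using p(2)[OF \<open>x \<in> cball 0 L\<close>] x by linarith
    then have fp: "f p > f z" using e by (simp add: w_def) (smt (verit) inner_ge_zero mult_nonneg_nonneg)
    then have pR: "norm p > R" using z[of p] by force
    have "e * (p \<bullet> p) < c - f z" using wp upper[of p] by (simp add: w_def)
    then have "p \<bullet> p < (c - f z) / e" using e by (simp add: field_simps)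
    moreover have "norm p \<le> p \<bullet> p"
      using pR R(1) mult_left_mono[of 1 "norm p" "norm p"]
      by (simp add: dot_square_norm power2_eq_square)
    ultimately have "p \<in> ball 0 L" by (simp add: L_def)
    have P': "(w has_derivative (\<lambda>v. (P y - (2 * e) *\<^sub>R y) \<bullet> v)) (at y)" for y
    proof -
      have "(w has_derivative (\<lambda>v. P y \<bullet> v - e * (y \<bullet> v + v \<bullet> y))) (at y)"
        unfolding w_def[abs_def]
        by (intro has_derivative_diff P has_derivative_mult_right has_derivative_inner
            has_derivative_ident)
      then show ?thesis by (simp add: inner_diff_left inner_commute[of _ y] mult_ac)
    qed
    have Q': "((\<lambda>y. P y - (2 * e) *\<^sub>R y) has_derivative
        (\<lambda>v. (Q p - (2 * e) *\<^sub>R mat 1) *v v)) (at p)"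
      by (rule derivative_eq_intros Q refl)+
        (simp add: fun_eq_iff matrix_vector_mult_diff_rdistrib mat_1_scaleR_vec)
    have mx: "w y \<le> w p" if "y \<in> ball 0 L" for y using p(2) that by auto
    note test = trace_hessian_nonpos_at_max[OF open_ball \<open>p \<in> ball 0 L\<close> P' Q' mx a[of p]]
    \<comment> \<open>At \<open>p\<close> the gradient is \<open>P p = (2 * e) *\<^sub>R p\<close>,
      so the right side of \<open>eq\<close> equals \<open>e * (p \<bullet> p)\<close>, while the
      left side is at most \<open>2 * e * G s0\<close>, which is strictly smaller.\<close>
    have "trace (a p ** Q p) \<le> 2 * e * trace (a p)"
      using test(2) by (simp add: trace_mult_diff_right trace_mult_scaleR_right)
    also have "trace (a p) \<le> G s0"
      using tr[of p] s0[of "f p"] upper[of p] fp f0z by force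
    then have "2 * e * trace (a p) \<le> 2 * e * G s0" using e by simp
    also have "\<dots> < e * (R * R)" using R(2) e by simp
    also have "\<dots> \<le> e * (p \<bullet> p)"
      using e pR R(1) by (simp add: dot_square_norm power2_eq_square mult_mono)
    also have "\<dots> = 1/2 * (p \<bullet> P p)" using test(1) by simp
    finally show False using eq[of p] by simp
  qed
  have "f x \<le> f z" for x
  proof (rule field_le_epsilon)
    fix e :: real assume e: "e > 0"
    have N: "x \<bullet> x + 1 > 0" by (simp add: add_nonneg_pos)
    \<comment> \<open>The barrier coefficient is scaled so that its contribution at this fixed
      \<open>x\<close> is at most \<open>e\<close>.\<close>
    have "f x \<le> f z + e / (x \<bullet> x + 1) * (x \<bullet> x)" by (rule barrier) (use e N in simp)
    also have "e / (x \<bullet> x + 1) * (x \<bullet> x) \<le> e" using e N by (simp add: field_simps)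
    finally show "f x \<le> f z + e" by simp
  qed
  then show ?thesis by blast
qed

section \<open>Strong maximum principle\<close>

text \<open>Hopf's barrier argument. A ball touches the set \<open>Z\<close> of maximum points at a
  single point \<open>q\<close>. Adding a small multiple of a strict subsolution \<open>h\<close> to
  \<open>f\<close> creates an interior maximum near \<open>q\<close>, where the operator
  \<open>trace (a x ** D\<^sup>2w) - b x \<bullet> Dw\<close> would be positive, against the
  second-order test.\<close>

lemma strong_maximum_principle:
  fixes f :: "real^'n \<Rightarrow> real" and a Q :: "real^'n \<Rightarrow> real^'n^'n"
    and b :: "real^'n \<Rightarrow> real^'n"
  assumes P: "\<And>x. (f has_derivative (\<lambda>v. P x \<bullet> v)) (at x)"
    and Q: "\<And>x. (P has_derivative (\<lambda>v. Q x *v v)) (at x)"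
    and a: "\<And>x. positive_definite (a x)"
    and a_cont: "continuous_on UNIV a" and b_cont: "continuous_on UNIV b"
    and eq: "\<And>x. trace (a x ** Q x) = b x \<bullet> P x"
    and max: "\<And>x. f x \<le> f z"
  shows "f y = f z"
proof (rule ccontr)
  assume y: "f y \<noteq> f z"
  have fcont: "continuous_on A f" for A
    by (intro continuous_at_imp_continuous_on ballI has_derivative_continuous[OF P])
  define Z where "Z = {x. f x = f z}"
  have "closed Z" unfolding Z_def by (intro closed_Collect_eq fcont continuous_intros)
  moreover have "Z \<noteq> {}" by (auto simp: Z_def)
  ultimately obtain q where q: "q \<in> Z" "\<And>x. x \<in> Z \<Longrightarrow> dist y q \<le> dist y x"
    using distance_attains_inf by metis
  \<comment> \<open>The ball with diameter from \<open>y\<close> to \<open>q\<close> is internally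
    tangent at \<open>q\<close> to the largest open ball about \<open>y\<close> free of
    \<open>Z\<close>.\<close>
  define m where "m = (1/2) *\<^sub>R (y + q)"
  define r where "r = dist y q / 2"
  have r: "r > 0" using q(1) y by (auto simp: r_def Z_def)
  have mq: "dist m q = r"
    unfolding m_def r_def dist_norm
    by (metis dist_midpoint(4) dist_norm midpoint_def inverse_eq_divide)
  \<comment> \<open>by the parallelogram law, \<open>q\<close> is the only point of \<open>Z\<close> in \<open>cball m r\<close>\<close>
  have less: "f x < f z" if x: "x \<in> cball m r" "x \<noteq> q" for x
  proof (rule ccontr)
    assume "\<not> f x < f z"
    then have "x \<in> Z" using max[of x] by (simp add: Z_def)
    then have "dist y q \<le> dist y x" by (rule q(2))
    then have 1: "(norm (y - q))\<^sup>2 \<le> (norm (x - y))\<^sup>2"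
      by (simp add: dist_norm norm_minus_commute)
    have "norm (x - m) \<le> r" using x(1) by (simp add: dist_norm norm_minus_commute)
    then have 2: "(norm (x - m))\<^sup>2 \<le> r\<^sup>2" by (simp add: power_mono)
    have 3: "4 * r\<^sup>2 = (norm (y - q))\<^sup>2" by (simp add: r_def dist_norm power2_eq_square)
    have "2 * (norm (x - y))\<^sup>2 + 2 * (norm (x - q))\<^sup>2 = 4 * (norm (x - m))\<^sup>2 + (norm (y - q))\<^sup>2"
      by (simp add: m_def power2_norm_eq_inner inner_diff_left inner_diff_right
          inner_add_left inner_add_right inner_commute algebra_simps)
    then have "(norm (x - q))\<^sup>2 \<le> 0" using 1 2 3 by linarith
    then show False using x(2) by simp
  qed
  \<comment> \<open>Radius \<open>r / 2\<close> keeps the centre \<open>m\<close> out of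
    \<open>B\<close>, so that ellipticity bounds the form at \<open>x - m\<close> below by some
    \<open>l > 0\<close>.\<close>
  define B where "B = cball q (r / 2)"
  have qB: "q \<in> B" using r by (simp add: B_def)
  have away: "x - m \<noteq> 0" if "x \<in> B" for x
  proof
    assume "x - m = 0"
    then have "dist q m \<le> r / 2" using that by (simp add: B_def)
    then show False using mq r by (simp add: dist_commute)
  qed
  have a_cont': "continuous_on B a" and b_cont': "continuous_on B b"
    using a_cont b_cont continuous_on_subset by blast+
  have av_cont: "continuous_on B (\<lambda>x. (x - m) \<bullet> (a x *v (x - m)))"
    unfolding matrix_vector_mult_def inner_vec_def
    by (simp, intro continuous_intros a_cont')
  obtain x1 where x1: "x1 \<in> B" "\<And>x. x \<in> B \<Longrightarrow>
      (x1 - m) \<bullet> (a x1 *v (x1 - m)) \<le> (x - m) \<bullet> (a x *v (x - m))"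
    using continuous_attains_inf[OF _ _ av_cont] qB by (auto simp: B_def)
  define l where "l = (x1 - m) \<bullet> (a x1 *v (x1 - m))"
  have l: "l > 0" using a[of x1] away[OF x1(1)] by (auto simp: l_def positive_definite_def)
  have "continuous_on B (\<lambda>x. trace (a x) - b x \<bullet> (x - m))"
    unfolding trace_def by (intro continuous_intros a_cont' b_cont')
  then obtain x2 where x2: "\<And>x. x \<in> B \<Longrightarrow>
      trace (a x) - b x \<bullet> (x - m) \<le> trace (a x2) - b x2 \<bullet> (x2 - m)"
    using continuous_attains_sup[of B "\<lambda>x. trace (a x) - b x \<bullet> (x - m)"] qB
    by (metis B_def compact_cball empty_iff)
  define N where "N = trace (a x2) - b x2 \<bullet> (x2 - m)"
  \<comment> \<open>Steep enough for the second-order term of the barrier to dominate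
    \<open>N\<close>, the maximum over \<open>B\<close> of the remaining terms;
    \<open>\<bar>N\<bar> + 1\<close> also makes \<open>k\<close> positive.\<close>
  define k where "k = (\<bar>N\<bar> + 1) / l"
  have k: "k > 0" "k * l > N" using l by (auto simp: k_def)
  \<comment> \<open>The barrier \<open>h\<close> vanishes on the sphere of radius \<open>r\<close>
    about \<open>m\<close>, hence at \<open>q\<close>, and is negative outside it; \<open>h1\<close>
    and \<open>h2\<close> are its gradient and Hessian.\<close>
  define E where "E x = exp (- (k * ((x - m) \<bullet> (x - m))))" for x
  define h where "h x = E x - exp (- (k * r\<^sup>2))" for x
  define h1 where "h1 x = (- (2 * k * E x)) *\<^sub>R (x - m)" for x
  define h2 where "h2 x = E x *\<^sub>R ((4 * k\<^sup>2) *\<^sub>R (\<chi> i j. (x - m) $ i * (x - m) $ j) - (2 * k) *\<^sub>R mat 1)"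
    for x :: "real^'n"
  have E': "(E has_derivative (\<lambda>v. h1 x \<bullet> v)) (at x)" for x
    unfolding E_def[abs_def] h1_def
    by (rule derivative_eq_intros refl)+
      (simp add: fun_eq_iff inner_diff_left inner_diff_right inner_commute algebra_simps)
  have h': "(h has_derivative (\<lambda>v. h1 x \<bullet> v)) (at x)" for x
    unfolding h_def[abs_def] by (rule derivative_eq_intros E' refl)+ simp
  have h2_vec: "h2 x *v v = E x *\<^sub>R ((4 * k\<^sup>2 * ((x - m) \<bullet> v)) *\<^sub>R (x - m) - (2 * k) *\<^sub>R v)" for x v
    unfolding h2_def
    by (simp only: scaleR_matrix_vector_assoc[symmetric] matrix_vector_mult_diff_rdistrib
        outer_mult_vec matrix_vector_mul_lid scaleR_scaleR)
  have h1': "(h1 has_derivative (\<lambda>v. h2 x *v v)) (at x)" for x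
    unfolding h1_def[abs_def] h2_vec
    by (rule derivative_eq_intros E' refl)+
      (simp add: fun_eq_iff h1_def scaleR_diff_right power2_eq_square algebra_simps)
  have Lh: "trace (a x ** h2 x) - b x \<bullet> h1 x > 0" if "x \<in> B" for x
  proof -
    have "trace (a x ** h2 x) - b x \<bullet> h1 x
      = 2 * k * E x * (2 * k * ((x - m) \<bullet> (a x *v (x - m))) - (trace (a x) - b x \<bullet> (x - m)))"
      unfolding h2_def h1_def
      by (simp add: trace_mult_scaleR_right trace_mult_outer trace_mult_diff_right
          del: vector_minus_component) (simp add: power2_eq_square algebra_simps)
    moreover have "2 * k * ((x - m) \<bullet> (a x *v (x - m))) > N"
    proof -
      have "k * l \<le> k * ((x - m) \<bullet> (a x *v (x - m)))"
        using x1(2)[OF that] k(1) by (simp add: l_def)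
      moreover have "k * l > 0" using k l by simp
      ultimately show ?thesis using k(2) by linarith
    qed
    moreover have "E x > 0" by (simp add: E_def)
    ultimately show ?thesis using x2[OF that] k(1) by (simp add: N_def)
  qed
  have h_lt_1: "h x < 1" for x
  proof -
    have "E x \<le> 1" using k(1) by (simp add: E_def)
    then show ?thesis using exp_gt_zero[of "- (k * r\<^sup>2)"] unfolding h_def by linarith
  qed
  have h_neg: "h x < 0" if "x \<notin> cball m r" for x
  proof -
    have "r < norm (x - m)" using that by (simp add: dist_norm norm_minus_commute)
    then have "r\<^sup>2 < (x - m) \<bullet> (x - m)"
      using r by (simp add: power_strict_mono flip: power2_norm_eq_inner)
    then show ?thesis using k(1) by (simp add: h_def E_def)
  qed
  have h_q: "h q = 0"
    using mq by (simp add: h_def E_def dist_norm norm_minus_commute flip: power2_norm_eq_inner)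
  \<comment> \<open>Compact and without \<open>q\<close>, so \<open>f\<close> stays below
    \<open>f z\<close> by a uniform gap \<open>e\<close> on \<open>C\<close>. If \<open>C\<close> is
    empty, any positive \<open>e\<close> serves.\<close>
  define C where "C = sphere q (r / 2) \<inter> cball m r"
  obtain e where e: "e > 0" "\<And>x. x \<in> C \<Longrightarrow> f x + e \<le> f z"
  proof (cases "C = {}")
    case True
    then show ?thesis using that[of 1] by simp
  next
    case False
    have "compact C" by (simp add: C_def compact_Int)
    then obtain x0 where x0: "x0 \<in> C" "\<And>x. x \<in> C \<Longrightarrow> f x \<le> f x0"
      using continuous_attains_sup[OF _ False fcont] by blast
    have "x0 \<noteq> q" using x0(1) r by (auto simp: C_def)
    then have "f x0 < f z" using x0(1) less by (simp add: C_def)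
    then show ?thesis using that[of "f z - f x0"] x0(2) by simp
  qed
  define w where "w x = f x + e * h x" for x
  have w': "(w has_derivative (\<lambda>v. (P x + e *\<^sub>R h1 x) \<bullet> v)) (at x)" for x
    unfolding w_def[abs_def]
    by (rule derivative_eq_intros P h' refl)+ (simp add: fun_eq_iff inner_add_left)
  have w'': "((\<lambda>x. P x + e *\<^sub>R h1 x) has_derivative (\<lambda>v. (Q x + e *\<^sub>R h2 x) *v v)) (at x)" for x
    by (rule derivative_eq_intros Q h1' refl)+
      (simp add: fun_eq_iff matrix_vector_mult_add_rdistrib scaleR_matrix_vector_assoc)
  have "continuous_on B w"
    by (intro continuous_at_imp_continuous_on ballI has_derivative_continuous[OF w'])
  then obtain p where p: "p \<in> B" "\<And>x. x \<in> B \<Longrightarrow> w x \<le> w p"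
    using continuous_attains_sup[of B w] qB by (metis B_def compact_cball empty_iff)
  have wp: "w p \<ge> f z" using p(2)[OF qB] q(1) h_q by (simp add: w_def Z_def)
  \<comment> \<open>On the sphere \<open>w < f z\<close>: inside \<open>cball m r\<close> the gap
    \<open>e\<close> beats \<open>e * h < e\<close>, and outside it \<open>h\<close> is negative.
    Since \<open>w q = f z\<close>, the maximum over \<open>B\<close> is interior.\<close>
  have "p \<notin> sphere q (r / 2)"
  proof
    assume s: "p \<in> sphere q (r / 2)"
    show False
    proof (cases "p \<in> cball m r")
      case True
      then have "f p + e \<le> f z" using s e(2) by (simp add: C_def)
      moreover have "e * h p < e" using e(1) h_lt_1[of p] by simp
      ultimately show False using wp by (simp add: w_def)
    next
      case False
      then have "e * h p < 0" using h_neg e(1) by (simp add: mult_pos_neg)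
      then show False using wp max[of p] by (simp add: w_def)
    qed
  qed
  then have pb: "p \<in> ball q (r / 2)" using p(1) by (auto simp: B_def)
  have mx: "w x \<le> w p" if "x \<in> ball q (r / 2)" for x
    using p(2) that by (auto simp: B_def)
  note test = trace_hessian_nonpos_at_max[OF open_ball pb w' w'' mx a[of p]]
  have "P p = - (e *\<^sub>R h1 p)" using test(1) by (simp add: eq_neg_iff_add_eq_0)
  then have "b p \<bullet> P p = - (e * (b p \<bullet> h1 p))" by simp
  moreover have "trace (a p ** Q p) + e * trace (a p ** h2 p) \<le> 0"
    using test(2) by (simp add: matrix_add_ldistrib trace_add trace_mult_scaleR_right)
  ultimately have "e * (trace (a p ** h2 p) - b p \<bullet> h1 p) \<le> 0"
    using eq[of p] by (simp add: right_diff_distrib)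
  then show False using Lh[OF p(1)] e(1) by (simp add: mult_le_0_iff)
qed

section \<open>Euler's relation on a line\<close>

text \<open>Euler's relation makes \<open>h t / t\<close> constant for \<open>t > 0\<close>.
  Differentiability at 0 identifies this constant with \<open>h' 0\<close>.\<close>

lemma homogeneous_real_linear:
  fixes h h' :: "real \<Rightarrow> real"
  assumes h: "\<And>t. (h has_real_derivative h' t) (at t)" and hom: "\<And>t. t * h' t = h t"
  shows "h 1 = h' 0"
proof -
  have h0: "h 0 = 0" using hom[of 0] by simp
  have ray: "h t / t = h 1" if t: "0 < t" "t < 1" for t
  proof -
    have d: "((\<lambda>s. h s / s) has_real_derivative 0) (at s)" if "s > 0" for s
    proof -
      have "((\<lambda>s. h s / s) has_real_derivative (h' s * s - h s * 1) / (s * s)) (at s)"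
        using that by (intro DERIV_divide h DERIV_ident) simp
      then show ?thesis using hom[of s] by (simp add: mult.commute)
    qed
    have "h 1 / 1 = h t / t"
    proof (rule DERIV_isconst_end[OF t(2)])
      show "continuous_on {t..1} (\<lambda>s. h s / s)"
        using t by (intro continuous_at_imp_continuous_on ballI DERIV_isCont[OF d]) simp
    qed (use t d in simp)
    then show ?thesis by simp
  qed
  have "((\<lambda>t. (h t - h 0) / (t - 0)) \<longlongrightarrow> h' 0) (at_right 0)"
    using h[of 0] unfolding has_field_derivative_iff by (simp add: filterlim_at_split)
  moreover have "\<forall>\<^sub>F t in at_right 0. (h t - h 0) / (t - 0) = h 1"
    using ray h0 by (auto simp: eventually_at_right_field intro!: exI[of _ 1])
  ultimately have "((\<lambda>t::real. h 1) \<longlongrightarrow> h' 0) (at_right 0)"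
    by (rule Lim_transform_eventually)
  then show ?thesis by (simp add: tendsto_const_iff)
qed

section \<open>Coordinate derivatives and the linearized coefficient matrix\<close>

lemma has_derivative_gradient:
  assumes "f differentiable (at x)"
  shows "(f has_derivative (\<lambda>v. gradient f x \<bullet> v)) (at x)"
proof -
  define f' where "f' = frechet_derivative f (at x)"
  have f': "(f has_derivative f') (at x)"
    using assms unfolding f'_def frechet_derivative_works .
  have "f' v = gradient f x \<bullet> v" for v
  proof -
    have "f' v = f' (\<Sum>i\<in>UNIV. v $ i *\<^sub>R axis i 1)"
      by (simp add: basis_expansion flip: scalar_mult_eq_scaleR)
    also have "\<dots> = (\<Sum>i\<in>UNIV. v $ i *\<^sub>R f' (axis i 1))"
      by (simp add: linear_sum[OF has_derivative_linear[OF f']]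
          linear_scale[OF has_derivative_linear[OF f']])
    finally show ?thesis
      by (simp add: gradient_def inner_vec_def f'_def mult.commute)
  qed
  then have "f' = (\<lambda>v. gradient f x \<bullet> v)" by blast
  with f' show ?thesis by simp
qed

lemma has_derivative_vecI:
  fixes f :: "'a::real_normed_vector \<Rightarrow> 'b::euclidean_space^'n"
  assumes "\<And>i. ((\<lambda>x. f x $ i) has_derivative (\<lambda>v. f' v $ i)) (at a)"
  shows "(f has_derivative f') (at a)"
  unfolding has_derivative_componentwise_within[of f]
  using assms by (auto simp: Basis_vec_def inner_axis intro!: has_derivative_inner_left)

lemma matrix_unit_expansion:
  fixes K :: "real^'n^'m"
  shows "K = (\<Sum>i\<in>UNIV. \<Sum>j\<in>UNIV. K $ i $ j *\<^sub>R axis i (axis j 1))"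
proof -
  have "(\<Sum>j\<in>UNIV. if p then h j else 0) = (if p then (\<Sum>j\<in>UNIV. h j) else 0)"
    for p and h :: "'n \<Rightarrow> real"
    by simp
  then show ?thesis
    by (simp add: vec_eq_iff axis_def if_distrib[of "\<lambda>x. _ * x"]
        if_distrib[of "\<lambda>x. x $ _"] cong: if_cong)
qed

lemma Sym_nth: "A \<in> Sym \<Longrightarrow> A $ i $ j = A $ j $ i"
  by (simp add: Sym_def transpose_def vec_eq_iff)

text \<open>Symmetrising the values of \<open>F'\<close> on matrix units represents it on
  \<open>Sym\<close> by the trace pairing; uniqueness holds because that pairing is definite on
  \<open>Sym\<close>. The explicit formula later gives continuity.\<close>

lemma linearized_coeff:
  fixes F :: "real^'n^'n \<Rightarrow> real" and F' :: "(real^'n^'n) \<Rightarrow>\<^sub>L real"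
  assumes U: "openin (top_of_set Sym) U" and B: "B \<in> U"
    and F': "(F has_derivative blinfun_apply F') (at B within U)"
  shows "linearized_coeff F B
      = (\<chi> i j. (F' (axis i (axis j 1)) + F' (axis j (axis i 1))) / 2)" (is "_ = ?A")
    and "K \<in> Sym \<Longrightarrow> trace (linearized_coeff F B ** K) = F' K"
proof -
  obtain V where V: "open V" "U = Sym \<inter> V" using U by (auto simp: openin_open)
  have A_Sym: "?A \<in> Sym" by (simp add: Sym_def transpose_def vec_eq_iff add.commute)
  have tr: "trace (?A ** K) = F' K" if "K \<in> Sym" for K
  proof -
    have 1: "F' K = (\<Sum>i\<in>UNIV. \<Sum>j\<in>UNIV. K $ i $ j * F' (axis i (axis j 1)))"
      by (subst matrix_unit_expansion[of K]) (simp add: blinfun.sum_right blinfun.scaleR_right)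
    also have "\<dots> = (\<Sum>i\<in>UNIV. \<Sum>j\<in>UNIV. K $ j $ i * F' (axis i (axis j 1)))"
      by (intro sum.cong refl) (metis Sym_nth[OF that])
    also have "\<dots> = (\<Sum>j\<in>UNIV. \<Sum>i\<in>UNIV. K $ j $ i * F' (axis i (axis j 1)))"
      by (rule sum.swap)
    finally have 2: "F' K = (\<Sum>i\<in>UNIV. \<Sum>j\<in>UNIV. K $ i $ j * F' (axis j (axis i 1)))" .
    have "trace (?A ** K) = (\<Sum>i\<in>UNIV. \<Sum>j\<in>UNIV. K $ i $ j * F' (axis i (axis j 1)) / 2
        + K $ i $ j * F' (axis j (axis i 1)) / 2)"
      unfolding trace_mult
    proof (intro sum.cong refl)
      fix i j
      show "?A $ i $ j * K $ j $ i = K $ i $ j * F' (axis i (axis j 1)) / 2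
        + K $ i $ j * F' (axis j (axis i 1)) / 2"
        using Sym_nth[OF that, of j i] by (simp add: field_simps)
    qed
    also have "\<dots> = F' K / 2 + F' K / 2"
      unfolding sum.distrib by (subst 1, subst 2) (simp add: sum_divide_distrib)
    finally show ?thesis by simp
  qed
  have deriv: "((\<lambda>t. F (B + t *\<^sub>R K)) has_real_derivative F' K) (at 0)" if K: "K \<in> Sym" for K
  proof -
    \<comment> \<open>Parameters for which the line stays in \<open>V\<close>: on this open
      neighbourhood of 0 it lies in \<open>U\<close>, so the derivative within \<open>U\<close>
      gives a two-sided derivative in \<open>t\<close>.\<close>
    define S where "S = (\<lambda>t::real. B + t *\<^sub>R K) -` V"
    have "open S" unfolding S_def by (intro open_vimage V continuous_intros)
    have BS: "B \<in> Sym" "B \<in> V" using B V by auto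
    then have "0 \<in> S" by (simp add: S_def)
    have "B + t *\<^sub>R K \<in> Sym" for t
      using BS(1) K by (simp add: Sym_def transpose_def vec_eq_iff)
    then have "(\<lambda>t. B + t *\<^sub>R K) ` S \<subseteq> U" by (auto simp: S_def V)
    then have F0: "(F has_derivative F') (at (B + 0 *\<^sub>R K) within (\<lambda>t. B + t *\<^sub>R K) ` S)"
      using F' by (auto intro: has_derivative_subset)
    have "((\<lambda>t. B + t *\<^sub>R K) has_derivative (\<lambda>t. t *\<^sub>R K)) (at 0 within S)"
      by (auto intro!: derivative_eq_intros)
    from has_derivative_in_compose[OF this F0]
    have "((\<lambda>t. F (B + t *\<^sub>R K)) has_derivative (\<lambda>t. F' (t *\<^sub>R K))) (at 0 within S)" .
    then show ?thesis
      unfolding at_within_open[OF \<open>0 \<in> S\<close> \<open>open S\<close>]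
      by (simp add: has_field_derivative_def blinfun.scaleR_right mult_commute_abs)
  qed
  show *: "linearized_coeff F B = ?A"
    unfolding linearized_coeff_def
  proof (rule the_equality)
    show "?A \<in> Sym \<and> (\<forall>K\<in>Sym. ((\<lambda>t. F (B + t *\<^sub>R K)) has_real_derivative trace (?A ** K)) (at 0))"
      using A_Sym deriv tr by simp
  next
    fix A assume A: "A \<in> Sym \<and>
      (\<forall>K\<in>Sym. ((\<lambda>t. F (B + t *\<^sub>R K)) has_real_derivative trace (A ** K)) (at 0))"
    \<comment> \<open>For symmetric \<open>D\<close>, \<open>trace (D ** D)\<close> is the sum of
      squares of the entries; testing both matrices against their difference makes it
      vanish.\<close>
    define D where "D = A - ?A"
    have D: "D \<in> Sym"
      using A A_Sym by (simp add: D_def Sym_def transpose_def vec_eq_iff)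
    then have "trace (A ** D) = trace (?A ** D)"
      using A deriv[OF D] tr[OF D] DERIV_unique by metis
    then have "trace (D ** D) = 0"
      by (simp add: D_def trace_mult left_diff_distrib sum_subtractf)
    moreover have "trace (D ** D) = (\<Sum>i\<in>UNIV. \<Sum>j\<in>UNIV. (D $ i $ j)\<^sup>2)"
      unfolding trace_mult power2_eq_square by (intro sum.cong refl) (metis Sym_nth[OF D])
    ultimately have "(\<Sum>i\<in>UNIV. \<Sum>j\<in>UNIV. (D $ i $ j)\<^sup>2) = 0" by simp
    then have "D $ i $ j = 0" for i j
      by (simp add: sum_nonneg_eq_0_iff sum_nonneg)
    then show "A = ?A" by (simp add: D_def vec_eq_iff)
  qed
  show "trace (linearized_coeff F B ** K) = F' K" if "K \<in> Sym"
    unfolding * by (rule tr[OF that])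
qed

section \<open>Constancy of \<open>F (hessian u x)\<close> and linearity of the gradient\<close>

theorem theorem1p2:
  fixes U :: "(real^'n^'n) set"
    and F :: "real^'n^'n \<Rightarrow> real"
    and c :: real
    and G :: "real \<Rightarrow> real"
    and u :: "real^'n \<Rightarrow> real"
  assumes U_open: "openin (top_of_set Sym) U"
    and F_C1: "C1_on U F"
    and ellipticity: "\<forall>B\<in>U. positive_definite (linearized_coeff F B)"
    and upper_bound: "\<forall>B\<in>U. F B \<le> c"
    and G_cont: "continuous_on {..c} G"
    and G_nonneg: "\<forall>s\<in>{..c}. 0 \<le> G s"
    and coeff_control: "\<forall>B\<in>U. trace (linearized_coeff F B) \<le> G (F B)"
    and u_C3: "Ck 3 u"
    and hessian_in: "\<forall>x. hessian u x \<in> U"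
    and equation: "\<forall>x. F (hessian u x) = 1/2 * (x \<bullet> gradient u x) - u x"
  shows "quadratic_polynomial u"
proof -
  obtain F' :: "real^'n^'n \<Rightarrow> (real^'n^'n) \<Rightarrow>\<^sub>L real"
    where F': "\<And>B. B \<in> U \<Longrightarrow> (F has_derivative F' B) (at B within U)" "continuous_on U F'"
    using F_C1 unfolding C1_on_def by blast
  define g where "g = gradient u"
  define H where "H = hessian u"
  \<comment> \<open>Third partial derivatives of \<open>u\<close>. Symmetry in \<open>i, j\<close>
    comes from \<open>U \<subseteq> Sym\<close>, symmetry in \<open>j, k\<close> from Schwarz's
    theorem for the first partials of \<open>u\<close>.\<close>
  define T where "T i j k x = frechet_derivative (\<lambda>y. H y $ i $ j) (at x) (axis k 1)" for i j k x
  define a where "a x = linearized_coeff F (H x)" for x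
  define f where "f x = F (H x)" for x
  have HU: "H x \<in> U" for x using hessian_in by (simp add: H_def)
  have H_Sym: "H x \<in> Sym" for x using HU U_open openin_subset by fastforce
  have u1: "u differentiable (at x)"
    and u2: "(\<lambda>y. frechet_derivative u (at y) v) differentiable (at x)"
    and u3: "(\<lambda>y. frechet_derivative (\<lambda>y. frechet_derivative u (at y) v) (at y) w)
      differentiable (at x)"
    and u4: "continuous_on UNIV (\<lambda>x. frechet_derivative (\<lambda>y. frechet_derivative
      (\<lambda>y. frechet_derivative u (at y) v) (at y) w) (at x) z)" for x v w z
    using u_C3 unfolding numeral_3_eq_3 by simp_all
  have g_nth: "g x $ i = frechet_derivative u (at x) (axis i 1)" for x i
    by (simp add: g_def gradient_def)
  have g_nth': "((\<lambda>y. g y $ i) has_derivative (\<lambda>v. gradient (\<lambda>y. g y $ i) x \<bullet> v)) (at x)" for x i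
    unfolding g_nth by (intro has_derivative_gradient u2)
  have "(g has_derivative (\<lambda>v. \<chi> i. gradient (\<lambda>y. g y $ i) x \<bullet> v)) (at x)" for x
    by (rule has_derivative_vecI) (simp add: g_nth')
  then have "g differentiable (at x)" for x unfolding differentiable_def by blast
  then have g': "(g has_derivative (\<lambda>v. H x *v v)) (at x)" for x
    using jacobian_works[of g "at x"] by (simp add: H_def hessian_def g_def)
  have H_nth: "H x $ i $ j = frechet_derivative (\<lambda>y. g y $ i) (at x) (axis j 1)" for x i j
  proof -
    have "((\<lambda>y. g y $ i) has_derivative (\<lambda>v. (H x *v v) $ i)) (at x)"
      by (rule bounded_linear.has_derivative[OF bounded_linear_vec_nth g'])
    then have "(\<lambda>v. (H x *v v) $ i) = frechet_derivative (\<lambda>y. g y $ i) (at x)"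
      by (rule frechet_derivative_at)
    then show ?thesis
      by (metis matrix_vector_mul_component inner_axis real_inner_1_right)
  qed
  have H_nth': "((\<lambda>y. H y $ i $ j) has_derivative (\<lambda>v. \<Sum>k\<in>UNIV. T i j k x * v $ k)) (at x)"
    for x i j
    using has_derivative_gradient[OF u3, of "axis i 1" "axis j 1" x]
    by (simp add: T_def H_nth g_nth gradient_def inner_vec_def)
  define dH where "dH x v = (\<chi> i j. \<Sum>k\<in>UNIV. T i j k x * v $ k)" for x and v :: "real^'n"
  have H': "(H has_derivative dH x) (at x)" for x
    by (intro has_derivative_vecI) (simp add: dH_def H_nth')
  have T_sym: "T i j k x = T j i k x" for i j k x
    unfolding T_def by (subst Sym_nth[OF H_Sym]) simp
  have dH_Sym: "dH x v \<in> Sym" for x v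
    unfolding Sym_def by (simp add: transpose_def dH_def vec_eq_iff T_sym)
  have T_swap: "T i j k x = T i k j x" for i j k x
    unfolding T_def H_nth g_nth by (intro frechet_derivative_swap u2 u3 u4)
  have f_eq: "f x = 1/2 * (x \<bullet> g x) - u x" for x
    using equation by (simp add: f_def H_def g_def)
  have u': "(u has_derivative (\<lambda>v. g x \<bullet> v)) (at x)" for x
    unfolding g_def by (intro has_derivative_gradient u1)
  \<comment> \<open>Gradient of \<open>x \<bullet> g x / 2 - u x\<close>. In its own derivative
    \<open>Q\<close> the terms with \<open>H\<close> cancel, leaving only third derivatives of
    \<open>u\<close>.\<close>
  define P where "P x = (1/2) *\<^sub>R (H x *v x) - (1/2) *\<^sub>R g x" for x
  define Q where "Q x = (\<chi> l m. 1/2 * (\<Sum>i\<in>UNIV. T l i m x * x $ i))" for x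
  have P: "(f has_derivative (\<lambda>v. P x \<bullet> v)) (at x)" for x
  proof -
    have "v \<bullet> (H x *v x) = x \<bullet> (H x *v v)" for v
      using symmetric_inner_commute H_Sym by (auto simp: Sym_def)
    then show ?thesis
      unfolding f_eq[abs_def] P_def
      by - (rule derivative_eq_intros g' u' refl | simp add: fun_eq_iff inner_diff_left inner_commute algebra_simps)+
  qed
  have Q: "(P has_derivative (\<lambda>v. Q x *v v)) (at x)" for x
  proof (rule has_derivative_vecI)
    fix l
    have "(\<Sum>m\<in>UNIV. (1/2 * (\<Sum>i\<in>UNIV. T l i m x * x $ i)) * v $ m)
      = 1/2 * (\<Sum>i\<in>UNIV. (\<Sum>m\<in>UNIV. T l i m x * v $ m) * x $ i)" for v :: "real^'n"
      by (simp add: sum_distrib_left sum_distrib_right mult_ac) (rule sum.swap)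
    then have eq: "(Q x *v v) $ l = 1/2 * (\<Sum>i\<in>UNIV. (\<Sum>m\<in>UNIV. T l i m x * v $ m) * x $ i)" for v
      by (simp add: Q_def matrix_vector_mult_def)
    have P_nth: "P y $ l = 1/2 * (\<Sum>i\<in>UNIV. H y $ l $ i * y $ i) - 1/2 * g y $ l" for y
      by (simp add: P_def matrix_vector_mult_def)
    have 1: "((\<lambda>y. H y $ l $ i * y $ i) has_derivative
        (\<lambda>v. H x $ l $ i * v $ i + (\<Sum>m\<in>UNIV. T l i m x * v $ m) * x $ i)) (at x)" for i
      by (intro has_derivative_mult H_nth' bounded_linear.has_derivative[OF bounded_linear_vec_nth]
          has_derivative_ident)
    have "((\<lambda>y. 1/2 * (\<Sum>i\<in>UNIV. H y $ l $ i * y $ i) - 1/2 * g y $ l) has_derivative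
        (\<lambda>v. 1/2 * (\<Sum>i\<in>UNIV. H x $ l $ i * v $ i + (\<Sum>m\<in>UNIV. T l i m x * v $ m) * x $ i)
          - 1/2 * (H x *v v) $ l)) (at x)"
      by (intro has_derivative_diff has_derivative_mult_right has_derivative_sum 1
          bounded_linear.has_derivative[OF bounded_linear_vec_nth] g')
    then show "((\<lambda>y. P y $ l) has_derivative (\<lambda>v. (Q x *v v) $ l)) (at x)"
      unfolding P_nth eq by (simp add: matrix_vector_mult_def sum.distrib algebra_simps)
  qed
  have lin: "P x \<bullet> v = trace (a x ** dH x v)" for x v
  proof -
    \<comment> \<open>\<open>F\<close> is differentiable only within \<open>U\<close>, so the chain
      rule is taken within \<open>range H\<close>.\<close>
    have "(F has_derivative F' (H x)) (at (H x) within range H)"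
      using F'(1)[OF HU] HU by (blast intro: has_derivative_subset)
    from has_derivative_in_compose[OF H' this]
    have "(f has_derivative (\<lambda>v. F' (H x) (dH x v))) (at x)"
      by (simp add: f_def[abs_def])
    then have "(\<lambda>v. P x \<bullet> v) = (\<lambda>v. F' (H x) (dH x v))"
      by (rule has_derivative_unique[OF P])
    then show ?thesis
      unfolding a_def using linearized_coeff(2)[OF U_open HU F'(1)[OF HU] dH_Sym] by metis
  qed
  have eq: "trace (a x ** Q x) = 1/2 * (x \<bullet> P x)" for x
  proof -
    \<comment> \<open>By \<open>T_swap\<close>, the Hessian of \<open>f\<close> is half the
      derivative of \<open>H\<close> in the direction \<open>x\<close>; \<open>lin\<close> with
      \<open>v = x\<close> then closes the equation.\<close>
    have "Q x = (1/2) *\<^sub>R dH x x"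
      unfolding Q_def dH_def by (simp add: vec_eq_iff T_swap[of _ _ _ x])
    then show ?thesis by (simp add: trace_mult_scaleR_right lin inner_commute[of x])
  qed
  have a_pos: "positive_definite (a x)" for x using ellipticity HU by (simp add: a_def)
  have H_cont: "continuous_on UNIV H"
    by (intro continuous_at_imp_continuous_on ballI has_derivative_continuous[OF H'])
  have "continuous_on UNIV (\<lambda>x. F' (H x))"
    by (rule continuous_on_compose2[OF F'(2) H_cont]) (use HU in blast)
  then have a_cont: "continuous_on UNIV a"
    unfolding a_def linearized_coeff(1)[OF U_open HU F'(1)[OF HU]]
    by (intro continuous_intros) auto
  obtain z where z: "\<And>x. f x \<le> f z"
    using bounded_above_solution_attains_max[OF P Q a_pos eq _ G_cont] upper_bound
      coeff_control HU by (metis a_def f_def)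
  have b: "trace (a x ** Q x) = ((1/2) *\<^sub>R x) \<bullet> P x" for x using eq by simp
  have "continuous_on UNIV (\<lambda>x::real^'n. (1/2) *\<^sub>R x)"
    by (intro continuous_intros)
  from strong_maximum_principle[OF P Q a_pos a_cont this b z]
  have f_const: "f x = f 0" for x
    by metis
  have hom: "H x *v x = g x" for x
  proof -
    have "(f has_derivative (\<lambda>v. 0)) (at x)"
      using f_const by (metis has_derivative_const ext)
    then have "(\<lambda>v. P x \<bullet> v) = (\<lambda>v. 0)" by (rule has_derivative_unique[OF P])
    then have "P x = 0" by (metis inner_eq_zero_iff)
    then show ?thesis by (simp add: P_def)
  qed
  have g_lin: "g x = H 0 *v x" for x
  proof -
    \<comment> \<open>By \<open>hom\<close>, each component of \<open>g\<close> along the ray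
      through \<open>x\<close> satisfies Euler's relation, so its value at \<open>t = 1\<close>
      equals its slope at \<open>t = 0\<close>.\<close>
    have "g x $ l = (H 0 *v x) $ l" for l
    proof -
      have "((\<lambda>t. g (t *\<^sub>R x) $ l) has_real_derivative (H (t *\<^sub>R x) *v x) $ l) (at t)" for t
      proof -
        have "((\<lambda>t. g (t *\<^sub>R x)) has_derivative (\<lambda>s. H (t *\<^sub>R x) *v (s *\<^sub>R x))) (at t)"
          by (rule has_derivative_compose[of "\<lambda>t. t *\<^sub>R x" "\<lambda>t. t *\<^sub>R x" t UNIV g])
            (auto intro!: derivative_eq_intros g')
        from bounded_linear.has_derivative[OF bounded_linear_vec_nth this, of l]
        show ?thesis
          by (simp add: has_field_derivative_def matrix_vector_mult_scaleR mult_commute_abs)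
      qed
      moreover have "t * (H (t *\<^sub>R x) *v x) $ l = g (t *\<^sub>R x) $ l" for t
        by (simp add: matrix_vector_mult_scaleR flip: hom)
      ultimately have "g (1 *\<^sub>R x) $ l = (H (0 *\<^sub>R x) *v x) $ l"
        by (rule homogeneous_real_linear)
      then show ?thesis by simp
    qed
    then show ?thesis by (simp add: vec_eq_iff)
  qed
  \<comment> \<open>At the origin \<open>f 0 = - u 0\<close>, so constancy of \<open>f\<close> reads
    \<open>u x = x \<bullet> g x / 2 + u 0\<close>.\<close>
  have u_eq: "u x = 1/2 * (x \<bullet> (H 0 *v x)) + u 0" for x
    using f_const[of x] f_eq[of x] f_eq[of 0] g_lin[of x] by simp
  have quad: "(\<Sum>i\<in>UNIV. \<Sum>j\<in>UNIV. (1/2 * H 0 $ i $ j) * x $ i * x $ j) = 1/2 * (x \<bullet> (H 0 *v x))"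
    for x
    by (simp add: inner_vec_def matrix_vector_mult_def sum_distrib_left mult_ac)
  show ?thesis
    unfolding quadratic_polynomial_def
  proof (intro exI allI)
    fix x
    show "u x = (\<Sum>i\<in>UNIV. \<Sum>j\<in>UNIV. (1/2 * H 0 $ i $ j) * x $ i * x $ j)
      + (\<Sum>i\<in>UNIV. 0 * x $ i) + u 0"
      unfolding quad using u_eq[of x] by simp
  qed
qed

end
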